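(* For all integers $q,p,x,y$, writing $B=B(q,p,x)$, $C=C(q,p,x,y)$, $F=F(q,p,x,y)$, $H=H(q,p,x,y)$, the following congruences hold: \begin{itemize} \item[(1)] $C \equiv p^3 \pmod{q^2}$; \item[(2)] $F \equiv p^4 \pmod{q^2}$; \item[(3)] $H \equiv p^6 \pmod{q^2}$; \item[(4)] $H \equiv -8C^2 \pmod{9|F|}$; \item[(5)] $p^4 - 2pC + F \equiv 0 \pmod{q^3}$; \item[(6)] $4p^6 - 5p^3 C + H \equiv 0 \pmod{q^3}$. \end{itemize}
   Context: The polynomials $B,C,F,H$ with integer coefficients are defined by $B(q,p,x) = p^2 - q^2x$, $C(q,p,x,y) = p^3 - 3pq^2x + 2q^3y$, $F(q,p,x,y) = 4pC - 3B^2$, and $H(q,p,x,y) = 9FB - 8C^2$ (where in the last two, $B$ and $C$ denote $B(q,p,x)$ and $C(q,p,x,y)$). For integers $a,b,m$, $a \equiv b \pmod m$ means that $m$ divides $a-b$ (so modulo $0$ it means $a=b$). *)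

theory Defs
  imports "HOL-Number_Theory.Cong"
begin

(* Congruences are the library's cong: on int it means divisibility of the difference
   for every modulus, zero and negative ones included (cong_iff_dvd_diff). *)

definition B :: "int \<Rightarrow> int \<Rightarrow> int \<Rightarrow> int" where
  "B q p x = p^2 - q^2 * x"

definition C :: "int \<Rightarrow> int \<Rightarrow> int \<Rightarrow> int \<Rightarrow> int" where
  "C q p x y = p^3 - 3 * p * q^2 * x + 2 * q^3 * y"

definition F :: "int \<Rightarrow> int \<Rightarrow> int \<Rightarrow> int \<Rightarrow> int" where
  "F q p x y = 4 * p * C q p x y - 3 * (B q p x)^2"

definition H :: "int \<Rightarrow> int \<Rightarrow> int \<Rightarrow> int \<Rightarrow> int" where
  "H q p x y = 9 * F q p x y * B q p x - 8 * (C q p x y)^2"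

end

theory Submission
  imports Defs
begin

text \<open>Expand in powers of \<open>q\<close>: there is no linear term, so \<open>C\<close>,
  \<open>F\<close>, \<open>H\<close> reduce to \<open>p^3\<close>, \<open>p^4\<close>,
  \<open>p^6\<close> modulo \<open>q^2\<close>; \<open>F_expand\<close> and \<open>H_expand\<close>
  factor out \<open>q^2\<close> to show this. The \<open>q^2\<close> coefficients are
  \<open>-3*p*x\<close>, \<open>-6*p^2*x\<close>, \<open>-15*p^4*x\<close>, and the combinations
  taken modulo \<open>q^3\<close> cancel both these and the pure powers of \<open>p\<close>.\<close>

lemma F_expand:
  "F q p x y = p^4 + q^2 * (- 6 * p^2 * x + 8 * p * q * y - 3 * q^2 * x^2)"
  unfolding F_def B_def C_def by algebra

lemma H_expand:
  "H q p x y = p^6 + q^2 * (- 15 * p^4 * x + 40 * p^3 * q * y - 45 * p^2 * q^2 * x^2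
     + 24 * p * q^3 * x * y + 27 * q^4 * x^3 - 32 * q^4 * y^2)"
  unfolding H_def F_def B_def C_def by algebra

theorem theorem2p3:
  fixes q p x y :: int
  shows "[C q p x y = p^3] (mod q^2) \<and>
         [F q p x y = p^4] (mod q^2) \<and>
         [H q p x y = p^6] (mod q^2) \<and>
         [H q p x y = - 8 * (C q p x y)^2] (mod (9 * \<bar>F q p x y\<bar>)) \<and>
         [p^4 - 2 * p * C q p x y + F q p x y = 0] (mod q^3) \<and>
         [4 * p^6 - 5 * p^3 * C q p x y + H q p x y = 0] (mod q^3)"
proof (intro conjI)
  have "C q p x y - p^3 = q^2 * (2 * q * y - 3 * p * x)"
    unfolding C_def by algebra
  then show "[C q p x y = p^3] (mod q^2)"
    by (simp add: cong_iff_dvd_diff)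
  show "[F q p x y = p^4] (mod q^2)"
    by (simp add: cong_iff_dvd_diff F_expand)
  show "[H q p x y = p^6] (mod q^2)"
    by (simp add: cong_iff_dvd_diff H_expand)
  have "9 * \<bar>F q p x y\<bar> dvd 9 * F q p x y * B q p x"
    by (simp add: mult.assoc)
  then show "[H q p x y = - 8 * (C q p x y)^2] (mod (9 * \<bar>F q p x y\<bar>))"
    by (simp add: cong_iff_dvd_diff H_def)
  \<comment> \<open>The \<open>q^2\<close> terms \<open>6*p^2*x\<close> from \<open>-2*p*C\<close>
    and \<open>-6*p^2*x\<close> from \<open>F\<close> cancel.\<close>
  have "p^4 - 2 * p * C q p x y + F q p x y = q^3 * (4 * p * y - 3 * q * x^2)"
    unfolding F_expand C_def by algebra
  then show "[p^4 - 2 * p * C q p x y + F q p x y = 0] (mod q^3)"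
    by (simp add: cong_0_iff)
  \<comment> \<open>The factor 5 matches \<open>-15*p^4*x\<close> in \<open>H\<close> against
    \<open>-3*p*x\<close> in \<open>C\<close>; then \<open>4 - 5 + 1 = 0\<close> removes
    \<open>p^6\<close>.\<close>
  have "4 * p^6 - 5 * p^3 * C q p x y + H q p x y =
      q^3 * (30 * p^3 * y - 45 * p^2 * q * x^2 + 24 * p * q^2 * x * y + 27 * q^3 * x^3 - 32 * q^3 * y^2)"
    unfolding H_expand C_def by algebra
  then show "[4 * p^6 - 5 * p^3 * C q p x y + H q p x y = 0] (mod q^3)"
    by (simp add: cong_0_iff)
qed

end
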